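(* Let $s$ be a positive integer and $m$ a nonnegative integer. The number of self-conjugate $(s,s+1,s+2)$-core partitions with $m$ corners is \[ \binom{\lfloor \frac{s}{2} \rfloor}{\lfloor \frac{m}{2} \rfloor,\ \lfloor \frac{m+1}{2} \rfloor,\ \lfloor \frac{s}{2} \rfloor-m}. \]
   Context: A partition is a finite (possibly empty) non-increasing sequence of positive integers, identified with its Young diagram. The number of corners of a partition is its number of distinct part sizes. The hook length of a box is the number of boxes to its right in the same row plus the number of boxes below it in the same column plus $1$. A partition is an $s$-core if no box has hook length $s$, and an $(s_1,\dots,s_q)$-core if it is an $s_i$-core for every $i$. A partition is self-conjugate if its Young diagram is invariant under reflection in the main diagonal. $\binom{n}{x,y,z}=\frac{n!}{x!\,y!\,z!}$ (with $x+y+z=n$) is the multinomial coefficient, understood to be $0$ if one of $x,y,z$ is negative. *)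

theory Defs
  imports Main
begin

definition is_partition :: "nat list \<Rightarrow> bool" where
  "is_partition p \<longleftrightarrow> sorted_wrt (\<ge>) p \<and> (\<forall>x\<in>set p. x > 0)"

text \<open>Boxes are \<open>(row, column)\<close>, both numbered from 0 (English convention).\<close>

definition young_diagram :: "nat list \<Rightarrow> (nat \<times> nat) set" where
  "young_diagram p = {(i, j). i < length p \<and> j < p ! i}"

definition hook_length :: "nat list \<Rightarrow> nat \<times> nat \<Rightarrow> nat" where
  "hook_length p = (\<lambda>(i, j).
     card {j'. j < j' \<and> (i, j') \<in> young_diagram p} +
     card {i'. i < i' \<and> (i', j) \<in> young_diagram p} + 1)"

definition is_core :: "nat \<Rightarrow> nat list \<Rightarrow> bool" where
  "is_core s p \<longleftrightarrow> \<not> (\<exists>b\<in>young_diagram p. hook_length p b = s)"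

definition is_multi_core :: "nat list \<Rightarrow> nat list \<Rightarrow> bool" where
  "is_multi_core ss p \<longleftrightarrow> (\<forall>s\<in>set ss. is_core s p)"

definition self_conjugate :: "nat list \<Rightarrow> bool" where
  "self_conjugate p \<longleftrightarrow> prod.swap ` young_diagram p = young_diagram p"

definition corners :: "nat list \<Rightarrow> nat" where
  "corners p = card (set p)"

text \<open>The lower arguments are integers, so that the convention for negative entries can be
  expressed. The notation is meaningful only for \<open>x + y + z = n\<close>, and then the division is exact
  (lemma \<open>multinomial3_exact\<close>).\<close>

definition multinomial3 :: "nat \<Rightarrow> int \<Rightarrow> int \<Rightarrow> int \<Rightarrow> nat" where
  "multinomial3 n x y z =
     (if x < 0 \<or> y < 0 \<or> z < 0 then 0
      else fact n div (fact (nat x) * fact (nat y) * fact (nat z)))"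

lemma multinomial3_exact:
  assumes "x \<ge> 0" "y \<ge> 0" "z \<ge> 0" "x + y + z = int n"
  shows "multinomial3 n x y z * (fact (nat x) * fact (nat y) * fact (nat z)) = fact n"
proof -
  define a b c where "a = nat x" and "b = nat y" and "c = nat z"
  have n: "n = a + b + c"
    using assms by (simp add: a_def b_def c_def)
  have "(fact a * fact b * fact c :: nat) dvd fact (a + b) * fact c"
    by (intro mult_dvd_mono fact_fact_dvd_fact dvd_refl)
  also have "\<dots> dvd fact n"
    unfolding n by (rule fact_fact_dvd_fact)
  finally show ?thesis
    using assms by (simp add: multinomial3_def a_def b_def c_def)
qed

end

theory Submission
  imports Defs "HOL-Combinatorics.Multiset_Permutations"
begin

text \<open>
  A partition \<open>\<lambda>\<close> is encoded by its beads \<open>\<lambda>\<^sub>i - i - 1\<close>, a set of integers whose complement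
  consists of the numbers \<open>j - \<lambda>'\<^sub>j\<close>. Hook lengths are differences of a bead and a smaller gap, so
  \<open>s\<close>-cores are the partitions whose bead set is closed under subtracting \<open>s\<close>; self-conjugacy is
  antisymmetry under \<open>x \<mapsto> -1 - x\<close>; and corners are beads \<open>x\<close> such that \<open>x - 1\<close> is a gap.

  Placing the beads on \<open>s + 1\<close> runners, an \<open>(s, s+1, s+2)\<close>-core becomes a quasi-periodic height
  function with steps in \<open>{-1, 0, 1}\<close>. Self-conjugacy makes it antisymmetric about two centres, so
  it is determined by \<open>\<lfloor>s/2\<rfloor>\<close> consecutive steps. The two centres force the sum of these steps to be
  \<open>0\<close> or \<open>-1\<close>, and the ascents in one period, which are the corners, are as many as the nonzero
  steps in this half period. So \<open>m\<close> corners mean \<open>\<lfloor>m/2\<rfloor>\<close> up and \<open>\<lfloor>(m+1)/2\<rfloor>\<close> down steps.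
\<close>

subsection \<open>Bead sets\<close>

text \<open>Rows past the end count as empty, so every \<open>i\<close> carries a bead and all
  sufficiently negative integers are beads.\<close>

definition part :: "nat list \<Rightarrow> nat \<Rightarrow> nat" where
  "part p i = (if i < length p then p ! i else 0)"

definition conj_part :: "nat list \<Rightarrow> nat \<Rightarrow> nat" where
  "conj_part p j = card {i. j < part p i}"

text \<open>The offset \<open>- 1\<close> gives the empty partition the negative integers as beads
  and makes conjugation the complement combined with \<open>x \<mapsto> -1 - x\<close>.\<close>

definition bead :: "nat list \<Rightarrow> nat \<Rightarrow> int" where
  "bead p i = int (part p i) - int i - 1"

definition beta_set :: "nat list \<Rightarrow> int set" where
  "beta_set p = range (bead p)"

lemma young_diagram_iff: "(i, j) \<in> young_diagram p \<longleftrightarrow> j < part p i"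
  by (auto simp: young_diagram_def part_def)

lemma part_antimono:
  assumes "is_partition p" "i \<le> k"
  shows "part p k \<le> part p i"
  using assms by (cases "i = k") (auto simp: is_partition_def part_def sorted_wrt_iff_nth_less)

lemma part_pos_iff: "is_partition p \<Longrightarrow> 0 < part p i \<longleftrightarrow> i < length p"
  by (auto simp: is_partition_def part_def)

lemma part_eqD:
  assumes "is_partition p" "is_partition q" "part p = part q"
  shows "p = q"
proof -
  have "i < length p \<longleftrightarrow> i < length q" for i
    using assms part_pos_iff by metis
  then have len: "length p = length q"
    by (meson linorder_neq_iff)
  show ?thesis
    using len assms(3) by (metis nth_equalityI part_def)
qed

lemma exists_partition:
  fixes g :: "nat \<Rightarrow> nat"
  assumes "antimono g" "g N = 0"
  shows "\<exists>p. is_partition p \<and> part p = g"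
proof -
  define L where "L = (LEAST L. g L = 0)"
  have "g L = 0"
    unfolding L_def using assms(2) by (rule LeastI)
  then have ge: "g i = 0" if "L \<le> i" for i
    using antimonoD[OF assms(1) that] by simp
  have lt: "0 < g i" if "i < L" for i
    using not_less_Least[of i "\<lambda>L. g L = 0"] that by (simp add: L_def)
  have "is_partition (map g [0..<L])"
    using lt antimonoD[OF assms(1)] by (auto simp: is_partition_def sorted_wrt_iff_nth_less)
  moreover have "part (map g [0..<L]) = g"
    using ge by (auto simp: part_def fun_eq_iff)
  ultimately show ?thesis by blast
qed

text \<open>Row lengths decrease weakly, so the rows longer than \<open>j\<close> form an initial
  segment, whose size is its first missing index.\<close>

lemma less_conj_part_iff:
  assumes "is_partition p"
  shows "i < conj_part p j \<longleftrightarrow> j < part p i"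
proof -
  let ?A = "{i. j < part p i}"
  define c where "c = (LEAST c. part p c \<le> j)"
  have "part p (length p) \<le> j" by (simp add: part_def)
  then have c: "part p c \<le> j"
    unfolding c_def by (rule LeastI)
  have "j < part p i \<longleftrightarrow> i < c" for i
    using not_less_Least[of i "\<lambda>c. part p c \<le> j"] part_antimono[OF assms, of c i] c
    by (fastforce simp: c_def[symmetric])
  then have "?A = {..<c}" by auto
  then show ?thesis by (auto simp: conj_part_def)
qed

lemma conj_part_antimono:
  assumes "is_partition p" "j \<le> k"
  shows "conj_part p k \<le> conj_part p j"
  using less_conj_part_iff[OF assms(1)] assms(2)
  by (meson le_less_trans linorder_not_le order_refl)

lemma bead_less: "is_partition p \<Longrightarrow> i < k \<Longrightarrow> bead p k < bead p i"
  using part_antimono[of p i k] by (simp add: bead_def)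

text \<open>A strictly decreasing sequence enumerates its range from the maximum down, so the range
  determines it.\<close>

lemma strictly_decreasing_range_eqD:
  fixes f g :: "nat \<Rightarrow> int"
  assumes f: "\<And>i k. i < k \<Longrightarrow> f k < f i" and g: "\<And>i k. i < k \<Longrightarrow> g k < g i"
    and "range f = range g"
  shows "f = g"
proof
  \<comment> \<open>If \<open>f i = g k\<close>, then \<open>k < i\<close> would give
    \<open>f k = f i\<close>; hence \<open>k \<ge> i\<close> and \<open>g k \<le> g i\<close>. The
    roles of \<open>f\<close> and \<open>g\<close> are swapped below.\<close>
  have le: "f i \<le> g i"
    if f: "\<And>i k. i < k \<Longrightarrow> f k < f i" and g: "\<And>i k. i < k \<Longrightarrow> g k < g i"
      and range: "range f = range g" and IH: "\<And>k. k < i \<Longrightarrow> f k = g k" for f g :: "nat \<Rightarrow> int" and i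
  proof -
    obtain k where k: "f i = g k"
      using range by (metis rangeE rangeI)
    have "\<not> k < i"
      using IH[of k] f[of k i] k by auto
    then show ?thesis
      using g[of i k] k by (cases "i = k") auto
  qed
  show "f i = g i" for i
  proof (induction i rule: less_induct)
    case (less i)
    then show ?case
      using le[of f g i] le[of g f i] assms by (simp add: order_antisym)
  qed
qed

lemma beta_set_inj:
  assumes "is_partition p" "is_partition q" "beta_set p = beta_set q"
  shows "p = q"
proof -
  have "bead p = bead q"
    using assms by (intro strictly_decreasing_range_eqD) (auto simp: beta_set_def intro: bead_less)
  then have "part p = part q"
    by (simp add: fun_eq_iff bead_def)
  then show ?thesis using part_eqD assms by blast
qed

lemma beta_set_bdd_above: "is_partition p \<Longrightarrow> bdd_above (beta_set p)"
  unfolding beta_set_def bdd_above_def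
  by (metis bead_less le_less_linear less_imp_le not_gr_zero order_refl rangeE)

section \<open>Hooks and cores in terms of beads and gaps\<close>

lemma hook_length_eq:
  assumes "is_partition p" "j < part p i"
  shows "int (hook_length p (i, j)) = bead p i - (int j - int (conj_part p j))"
proof -
  have "{j'. j < j' \<and> (i, j') \<in> young_diagram p} = {j<..<part p i}"
    by (auto simp: young_diagram_iff)
  moreover have "{i'. i < i' \<and> (i', j) \<in> young_diagram p} = {i<..<conj_part p j}"
    using assms less_conj_part_iff by (auto simp: young_diagram_iff)
  ultimately show ?thesis
    using assms less_conj_part_iff[OF assms(1), of i j] by (simp add: hook_length_def bead_def)
qed

lemma bead_gt_iff:
  assumes "is_partition p"
  shows "int j - int (conj_part p j) < bead p i \<longleftrightarrow> j < part p i"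
  using less_conj_part_iff[OF assms, of i j] by (auto simp: bead_def)

text \<open>Walking along the rim of the diagram, the vertical steps are the beads and the horizontal
  steps are the gaps.\<close>

lemma compl_beta_set:
  assumes "is_partition p"
  shows "- beta_set p = range (\<lambda>j. int j - int (conj_part p j))"
proof (intro set_eqI iffI)
  fix z assume "z \<in> range (\<lambda>j. int j - int (conj_part p j))"
  then obtain j where z: "z = int j - int (conj_part p j)" by blast
  have "z \<noteq> bead p i" for i
    using less_conj_part_iff[OF assms, of i j] by (auto simp: z bead_def)
  then show "z \<in> - beta_set p" by (auto simp: beta_set_def)
next
  fix z assume "z \<in> - beta_set p"
  then have z: "bead p i \<noteq> z" for i by (auto simp: beta_set_def)
  \<comment> \<open>\<open>i\<close> counts the beads above \<open>z\<close>. A gap between two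
    consecutive beads must be the horizontal step of column \<open>z + int i\<close>.\<close>
  define i where "i = (LEAST i. bead p i < z)"
  have "bead p (length p + nat \<bar>z\<bar>) < z"
    by (simp add: bead_def part_def)
  then have i: "bead p i < z"
    unfolding i_def by (rule LeastI)
  have prev: "z < bead p k" if "k < i" for k
    using not_less_Least[of k "\<lambda>i. bead p i < z"] that z[of k] by (simp add: i_def)
  define j where "j = nat (z + int i)"
  have j: "int j = z + int i" "part p i \<le> j"
    using i by (auto simp: j_def bead_def)
  have "k < conj_part p j \<longleftrightarrow> k < i" for k
  proof (cases "k < i")
    case True
    have "k \<le> i - 1" using True by simp
    have "j < part p (i - 1)"
      using prev[of "i - 1"] True j by (simp add: bead_def of_nat_diff)
    then show ?thesis
      using True part_antimono[OF assms \<open>k \<le> i - 1\<close>] less_conj_part_iff[OF assms, of k j] by simp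
  next
    case False
    then show ?thesis
      using part_antimono[OF assms, of i k] j less_conj_part_iff[OF assms] by simp
  qed
  then have "conj_part p j = i"
    by (meson linorder_neq_iff)
  then show "z \<in> range (\<lambda>j. int j - int (conj_part p j))"
    using j by (intro image_eqI[of _ _ j]) auto
qed

text \<open>A box is a bead with a smaller gap, and its hook length is their difference. So a bead
  \<open>x\<close> with \<open>x - int s\<close> missing amounts to a box of hook length
  \<open>s\<close>; \<open>s > 0\<close> puts the gap below the bead.\<close>

lemma is_core_iff:
  assumes "is_partition p" "s > 0"
  shows "is_core s p \<longleftrightarrow> (\<forall>x\<in>beta_set p. x - int s \<in> beta_set p)"
proof
  assume core: "is_core s p"
  show "\<forall>x\<in>beta_set p. x - int s \<in> beta_set p"
  proof (rule ccontr)
    assume "\<not> ?thesis"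
    then obtain i where "bead p i - int s \<in> - beta_set p"
      by (auto simp: beta_set_def)
    then obtain j where j: "bead p i - int s = int j - int (conj_part p j)"
      using compl_beta_set[OF assms(1)] by auto
    then have box: "j < part p i"
      using bead_gt_iff[OF assms(1), of j i] assms(2) by simp
    then have "hook_length p (i, j) = s"
      using hook_length_eq[OF assms(1) box] j by simp
    then show False
      using core box by (auto simp: is_core_def young_diagram_iff)
  qed
next
  assume closed: "\<forall>x\<in>beta_set p. x - int s \<in> beta_set p"
  have "hook_length p (i, j) \<noteq> s" if "j < part p i" for i j
  proof
    assume "hook_length p (i, j) = s"
    then have "bead p i - int s = int j - int (conj_part p j)"
      using hook_length_eq[OF assms(1) that] by simp
    then have "bead p i - int s \<in> - beta_set p"
      using compl_beta_set[OF assms(1)] by auto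
    then show False using closed by (auto simp: beta_set_def)
  qed
  then show "is_core s p"
    by (metis is_core_def young_diagram_iff surj_pair)
qed

section \<open>Self-conjugacy and corners in terms of beads\<close>

lemma self_conjugate_iff_part:
  assumes "is_partition p"
  shows "self_conjugate p \<longleftrightarrow> conj_part p = part p"
proof -
  have "prod.swap ` young_diagram p = {(i, j). i < part p j}"
    unfolding set_eq_iff split_paired_All by (simp add: young_diagram_iff)
  moreover have "young_diagram p = {(i, j). j < part p i}"
    by (auto simp: young_diagram_iff)
  ultimately have "self_conjugate p \<longleftrightarrow> (\<forall>i j. i < part p j \<longleftrightarrow> j < part p i)"
    unfolding self_conjugate_def by (simp add: set_eq_iff)
  also have "\<dots> \<longleftrightarrow> (\<forall>j i. i < part p j \<longleftrightarrow> i < conj_part p j)"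
    using less_conj_part_iff[OF assms] by blast
  also have "\<dots> \<longleftrightarrow> conj_part p = part p"
    unfolding fun_eq_iff by (metis linorder_neq_iff)
  finally show ?thesis .
qed

lemma self_conjugate_iff:
  assumes "is_partition p"
  shows "self_conjugate p \<longleftrightarrow> (\<forall>x. x \<in> beta_set p \<longleftrightarrow> - 1 - x \<notin> beta_set p)"
proof -
  \<comment> \<open>\<open>?g\<close> lists the beads of the conjugate partition; its range is the
    reflected set of gaps.\<close>
  let ?g = "\<lambda>j. - 1 - (int j - int (conj_part p j))"
  have "self_conjugate p \<longleftrightarrow> ?g = bead p"
    using self_conjugate_iff_part[OF assms] by (auto simp: fun_eq_iff bead_def)
  also have "\<dots> \<longleftrightarrow> range ?g = beta_set p"
  proof
    have dec: "?g k < ?g i" if "i < k" for i k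
      using conj_part_antimono[OF assms, of i k] that by simp
    show "?g = bead p" if "range ?g = beta_set p"
      by (rule strictly_decreasing_range_eqD[OF dec bead_less[OF assms]])
        (use that in \<open>simp_all add: beta_set_def\<close>)
  qed (simp only: beta_set_def)
  also have "range ?g = (\<lambda>x. - 1 - x) ` (- beta_set p)"
    unfolding compl_beta_set[OF assms] image_image ..
  also have "\<dots> = {x. - 1 - x \<notin> beta_set p}"
    by (auto simp: image_iff intro!: bexI[of _ "- 1 - x" for x])
  finally show ?thesis by auto
qed

text \<open>Both sides count \<open>?I\<close>, the last rows of the blocks of equal rows: such a
  row represents its part size, and its bead has a gap just below because the next bead is more than
  1 lower.\<close>

lemma corners_eq:
  assumes "is_partition p"
  shows "corners p = card {x \<in> beta_set p. x - 1 \<notin> beta_set p}"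
proof -
  let ?I = "{i. part p (Suc i) < part p i}"
  have "bij_betw (part p) ?I (set p)"
  proof (rule bij_betw_imageI)
    show "inj_on (part p) ?I"
    proof (rule linorder_inj_onI)
      fix i k assume "i < k" "i \<in> ?I" "k \<in> ?I"
      then show "part p i \<noteq> part p k"
        using part_antimono[OF assms, of "Suc i" k] by simp
    qed auto
    show "part p ` ?I = set p"
    proof (intro equalityI subsetI)
      fix v assume "v \<in> part p ` ?I"
      then show "v \<in> set p" by (auto simp: part_def split: if_splits)
    next
      fix v assume "v \<in> set p"
      then obtain k where k: "v = part p k" "k < length p"
        by (auto simp: in_set_conv_nth part_def)
      then have "0 < v" using part_pos_iff[OF assms] by simp
      \<comment> \<open>Exactly \<open>c\<close> rows have length at least \<open>v\<close>, so row
        \<open>c - 1\<close> is the last one of length \<open>v\<close>.\<close>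
      define c where "c = conj_part p (v - 1)"
      have c: "i < c \<longleftrightarrow> v \<le> part p i" for i
        using less_conj_part_iff[OF assms, of i "v - 1"] \<open>0 < v\<close> by (auto simp: c_def)
      have "k < c" using c k by simp
      then have "v \<le> part p (c - 1)" "part p c < v"
        using c[of "c - 1"] c[of c] by auto
      moreover have "part p (c - 1) \<le> v"
        using part_antimono[OF assms, of k "c - 1"] \<open>k < c\<close> k by simp
      ultimately show "v \<in> part p ` ?I"
        using \<open>k < c\<close> by (intro image_eqI[of _ _ "c - 1"]) auto
    qed
  qed
  moreover have "bij_betw (bead p) ?I {x \<in> beta_set p. x - 1 \<notin> beta_set p}"
  proof (rule bij_betw_imageI)
    show "inj_on (bead p) ?I"
      by (rule linorder_inj_onI) (use bead_less[OF assms] in force)+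
    have "bead p i - 1 \<in> beta_set p \<longleftrightarrow> part p (Suc i) = part p i" for i
    proof
      assume "bead p i - 1 \<in> beta_set p"
      then obtain k where k: "bead p i - 1 = bead p k" by (auto simp: beta_set_def)
      then have "\<not> k \<le> i" using bead_less[OF assms, of k i] by (cases "k = i") auto
      moreover have "\<not> Suc i < k"
        using k bead_less[OF assms, of "Suc i" k] bead_less[OF assms, of i "Suc i"] by auto
      ultimately have "k = Suc i" by simp
      then show "part p (Suc i) = part p i" using k by (simp add: bead_def)
    next
      assume "part p (Suc i) = part p i"
      then have "bead p i - 1 = bead p (Suc i)" by (simp add: bead_def)
      then show "bead p i - 1 \<in> beta_set p" by (simp add: beta_set_def)
    qed
    then show "bead p ` ?I = {x \<in> beta_set p. x - 1 \<notin> beta_set p}"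
      using part_antimono[OF assms, of i "Suc i" for i]
      by (auto simp: beta_set_def less_le)
  qed
  ultimately show ?thesis
    unfolding corners_def by (metis bij_betw_same_card)
qed

section \<open>Partitions from symmetric sets\<close>

lemma card_symmetric_window:
  fixes S :: "int set" and N :: nat
  assumes "\<And>x. x \<in> S \<longleftrightarrow> - 1 - x \<notin> S"
  shows "card (S \<inter> {- int N..<int N}) = N"
proof -
  let ?T = "S \<inter> {- int N..<int N}"
  \<comment> \<open>The reflection exchanges members and non-members in a window of
    \<open>2 * N\<close> integers, so each kind makes up half of it.\<close>
  have "bij_betw (\<lambda>x. - 1 - x) ?T ({- int N..<int N} - S)"
  proof (rule bij_betwI[where g = "\<lambda>x. - 1 - x"])
    show "(\<lambda>x. - 1 - x) \<in> ?T \<rightarrow> {- int N..<int N} - S"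
    proof
      fix x assume "x \<in> ?T"
      then show "- 1 - x \<in> {- int N..<int N} - S" using assms[of x] by simp
    qed
    show "(\<lambda>x. - 1 - x) \<in> {- int N..<int N} - S \<rightarrow> ?T"
    proof
      fix x assume "x \<in> {- int N..<int N} - S"
      then show "- 1 - x \<in> ?T" using assms[of x] by simp
    qed
  qed simp_all
  then have "card ?T = card ({- int N..<int N} - S)"
    by (rule bij_betw_same_card)
  moreover have "card ({- int N..<int N} - S) = 2 * N - card ?T"
    by (subst card_Diff_subset_Int) (simp_all add: Int_commute)
  moreover have "card ?T \<le> 2 * N"
    using card_mono[of "{- int N..<int N}" ?T] by simp
  ultimately show ?thesis by simp
qed

lemma exists_beta_set:
  assumes sym: "\<And>x. x \<in> S \<longleftrightarrow> - 1 - x \<notin> S" and "bdd_above S"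
  shows "\<exists>p. is_partition p \<and> beta_set p = S"
proof -
  obtain M where M: "\<And>x. x \<in> S \<Longrightarrow> x \<le> M"
    using assms(2) by (auto simp: bdd_above_def)
  define N where "N = nat (M + 1)"
  have above: "x < int N" if "x \<in> S" for x
    using M[OF that] by (simp add: N_def)
  have below: "x \<in> S" if "x < - int N" for x
    using sym[of x] above[of "- 1 - x"] that by auto
  define T where "T = S \<inter> {- int N..<int N}"
  have "finite T" by (simp add: T_def)
  define xs where "xs = sorted_list_of_set T"
  have len: "length xs = N" and set_xs: "set xs = T"
    using card_symmetric_window[OF sym] \<open>finite T\<close> by (simp_all add: xs_def T_def)
  have xs_less: "xs ! i < xs ! k" if "i < k" "k < N" for i k
    using strict_sorted_list_of_set[of T] that len
    by (auto simp: xs_def sorted_wrt_iff_nth_less)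
  \<comment> \<open>\<open>f\<close> enumerates \<open>S\<close> decreasingly, so the increasing
    list \<open>xs\<close> is read backwards. The window holds exactly \<open>N\<close> members and
    everything below it lies in \<open>S\<close>, hence index \<open>N\<close> continues with
    \<open>- int N - 1\<close>.\<close>
  define f where "f i = (if i < N then xs ! (N - 1 - i) else - int i - 1)" for i
  have f_in: "f i \<in> T" if "i < N" for i
    using that len set_xs by (auto simp: f_def intro!: nth_mem)
  have f_less: "f k < f i" if "i < k" for i k
  proof (cases "k < N")
    case True
    then show ?thesis using that by (auto simp: f_def intro!: xs_less)
  next
    case False
    then show ?thesis
      using that f_in[of i] by (cases "i < N") (auto simp: f_def T_def)
  qed
  have range_f: "range f = S"
  proof (intro equalityI subsetI)
    fix x assume "x \<in> range f"
    then obtain i where "x = f i" by blast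
    then show "x \<in> S"
      using f_in[of i] by (cases "i < N") (auto simp: f_def T_def intro!: below)
  next
    fix x assume "x \<in> S"
    show "x \<in> range f"
    proof (cases "x < - int N")
      case True
      then have "x = f (nat (- 1 - x))" by (auto simp: f_def)
      then show ?thesis by blast
    next
      case False
      then have "x \<in> set xs" using \<open>x \<in> S\<close> above by (auto simp: set_xs T_def)
      then obtain i where "i < N" "x = xs ! i" by (auto simp: in_set_conv_nth len)
      then have "x = f (N - 1 - i)" by (auto simp: f_def)
      then show ?thesis by blast
    qed
  qed
  \<comment> \<open>This keeps \<open>nat\<close> in \<open>g\<close> below from truncating. The
    smallest member in the window is at least \<open>- int N\<close>, and each earlier index raises
    \<open>f\<close> by at least 1.\<close>
  have lower: "- int i - 1 \<le> f i" for i
  proof (cases "i < N")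
    case True
    then have "i \<le> N - 1" by simp
    then show ?thesis
    proof (induction rule: inc_induct)
      case base
      then show ?case using f_in[of "N - 1"] True by (simp add: T_def of_nat_diff)
    next
      case (step n)
      then show ?case using f_less[of n "Suc n"] by simp
    qed
  qed (simp add: f_def)
  define g where "g i = nat (f i + int i + 1)" for i
  have "antimono g"
    unfolding decseq_Suc_iff g_def using f_less[of i "Suc i" for i] by (smt (verit) lessI nat_mono of_nat_Suc)
  moreover have "g N = 0" by (simp add: g_def f_def)
  ultimately obtain p where p: "is_partition p" "part p = g"
    using exists_partition by blast
  have "bead p = f"
    using lower by (auto simp: bead_def p g_def fun_eq_iff) (smt (verit))
  then show ?thesis using p range_f by (auto simp: beta_set_def)
qed

subsection \<open>Height profiles\<close>

definition sym_core_set :: "nat \<Rightarrow> int set \<Rightarrow> bool" where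
  "sym_core_set s S \<longleftrightarrow> (\<forall>x. x \<in> S \<longleftrightarrow> - 1 - x \<notin> S) \<and> bdd_above S \<and>
     (\<forall>x\<in>S. x - int s \<in> S \<and> x - int (s + 1) \<in> S \<and> x - int (s + 2) \<in> S)"

lemma sym_core_set_flip: "sym_core_set s S \<Longrightarrow> x \<in> S \<longleftrightarrow> - 1 - x \<notin> S"
  unfolding sym_core_set_def by blast

lemma sym_core_set_bdd_above: "sym_core_set s S \<Longrightarrow> bdd_above S"
  unfolding sym_core_set_def by (elim conjE)

lemma sym_core_set_closed:
  assumes "sym_core_set s S" "x \<in> S"
  shows "x - int s \<in> S" "x - (int s + 1) \<in> S" "x - (int s + 2) \<in> S"
proof -
  have "\<forall>x\<in>S. x - int s \<in> S \<and> x - int (s + 1) \<in> S \<and> x - int (s + 2) \<in> S"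
    using assms(1) unfolding sym_core_set_def by (elim conjE)
  from bspec[OF this assms(2)]
  show "x - int s \<in> S" "x - (int s + 1) \<in> S" "x - (int s + 2) \<in> S"
    by (simp_all add: add.commute)
qed

lemma bij_betw_beta_set:
  assumes "s > 0"
  shows "bij_betw beta_set
    {p. is_partition p \<and> self_conjugate p \<and> is_multi_core [s, s + 1, s + 2] p \<and> corners p = m}
    {S. sym_core_set s S \<and> card {x \<in> S. x - 1 \<notin> S} = m}"
    (is "bij_betw _ ?P ?Q")
proof -
  have iff: "self_conjugate p \<and> is_multi_core [s, s + 1, s + 2] p \<longleftrightarrow> sym_core_set s (beta_set p)"
    if "is_partition p" for p
    using self_conjugate_iff[OF that] beta_set_bdd_above[OF that] is_core_iff[OF that, of s]
      is_core_iff[OF that, of "s + 1"] is_core_iff[OF that, of "s + 2"] assms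
    by (auto simp: sym_core_set_def is_multi_core_def)
  show ?thesis
  proof (rule bij_betw_imageI)
    show "inj_on beta_set ?P"
      by (auto intro: inj_onI beta_set_inj)
    show "beta_set ` ?P = ?Q"
    proof (intro equalityI subsetI)
      fix S assume "S \<in> beta_set ` ?P"
      then show "S \<in> ?Q" using iff corners_eq by auto
    next
      fix S assume S: "S \<in> ?Q"
      then have core: "sym_core_set s S" by blast
      obtain p where p: "is_partition p" "beta_set p = S"
        using exists_beta_set[OF sym_core_set_flip sym_core_set_bdd_above, OF core core] by blast
      then have "p \<in> ?P" using S iff[OF p(1)] corners_eq[OF p(1)] by blast
      then show "S \<in> beta_set ` ?P" using p(2) by blast
    qed
  qed
qed

text \<open>Arrange the integers in an array with \<open>s + 1\<close> columns. The column of \<open>x\<close> is filled up to some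
  height, and \<open>h x\<close> is that height counted from \<open>x\<close> (negative if \<open>x\<close> is not in the set). Being closed
  under subtraction of \<open>s\<close> and \<open>s + 2\<close> says that the heights of neighbouring columns differ by at
  most 1.\<close>

definition profile :: "nat \<Rightarrow> (int \<Rightarrow> int) \<Rightarrow> bool" where
  "profile s h \<longleftrightarrow> (\<forall>x. h (x + (int s + 1)) = h x - 1) \<and> (\<forall>x. h (- 1 - x) = - 1 - h x) \<and>
     (\<forall>x. \<bar>h (x + 1) - h x\<bar> \<le> 1)"

lemma profile_shift:
  assumes "profile s h"
  shows "h (x + a * (int s + 1)) = h x - a"
proof (induction a rule: int_induct[where k = 0])
  case base
  then show ?case by simp
next
  case (step1 a)
  have "h (x + (a + 1) * (int s + 1)) = h (x + a * (int s + 1) + (int s + 1))"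
    by (simp add: algebra_simps)
  then show ?case using step1 assms by (simp add: profile_def)
next
  case (step2 a)
  have "h (x + a * (int s + 1)) = h (x + (a - 1) * (int s + 1) + (int s + 1))"
    by (simp add: algebra_simps)
  then show ?case using step2 assms by (simp add: profile_def)
qed

lemma profile_div_mod:
  assumes "profile s h"
  shows "h x = h (x mod (int s + 1)) - x div (int s + 1)"
  using profile_shift[OF assms, of "x mod (int s + 1)" "x div (int s + 1)"]
  by (simp only: mod_div_mult_eq)

lemma profile_flip: "profile s h \<Longrightarrow> h (- 1 - x) = - 1 - h x"
  by (simp add: profile_def)

lemma profile_step: "profile s h \<Longrightarrow> \<bar>h (x + 1) - h x\<bar> \<le> 1"
  by (simp add: profile_def)

text \<open>The reflection about \<open>-1/2\<close> followed by a shift of one period gives a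
  second centre of antisymmetry at \<open>s/2\<close>.\<close>

lemma profile_reflect:
  assumes "profile s h"
  shows "h (int s - x) = - 2 - h x"
  using profile_shift[OF assms, of "- 1 - x" 1] profile_flip[OF assms, of x]
  by (simp add: algebra_simps)

lemma sym_core_set_profile:
  assumes "profile s h"
  shows "sym_core_set s {x. 0 \<le> h x}"
proof -
  have bdd: "bdd_above {x. 0 \<le> h x}"
  proof -
    \<comment> \<open>\<open>M\<close> bounds the heights in one period, and each further period
      lowers them by 1, so a nonnegative height bounds the quotient of \<open>x\<close> by
      \<open>M\<close>.\<close>
    define M where "M = Max (h ` {0..int s})"
    have "x \<le> (M + 1) * (int s + 1)" if "0 \<le> h x" for x
    proof -
      have "h (x mod (int s + 1)) \<le> M"
        unfolding M_def using pos_mod_bound[of "int s + 1" x] by (intro Max_ge) auto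
      then have "x div (int s + 1) \<le> M"
        using profile_div_mod[OF assms, of x] that by simp
      then have "x div (int s + 1) * (int s + 1) \<le> M * (int s + 1)"
        by (intro mult_right_mono) auto
      moreover have "x mod (int s + 1) < int s + 1" by (rule pos_mod_bound) simp
      ultimately have "x div (int s + 1) * (int s + 1) + x mod (int s + 1) \<le>
          M * (int s + 1) + 1 * (int s + 1)"
        by (intro add_mono) simp_all
      then show ?thesis
        by (simp only: div_mult_mod_eq distrib_right)
    qed
    then show ?thesis unfolding bdd_above_def by blast
  qed
  have mono: "h x \<le> h (x - int s)" "h x \<le> h (x - int (s + 1))" "h x \<le> h (x - int (s + 2))" for x
  proof -
    \<comment> \<open>Going back one period raises the height by 1, which pays for a step of at most
      1 to either neighbour.\<close>
    define y where "y = x - int (s + 1)"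
    have y: "x - int (s + 1) = y" "x - int s = y + 1" "x - int (s + 2) = y - 1"
      by (simp_all add: y_def)
    have "h y = h x + 1"
      using profile_shift[OF assms, of x "- 1"] by (simp add: y_def algebra_simps)
    then show "h x \<le> h (x - int s)" "h x \<le> h (x - int (s + 1))" "h x \<le> h (x - int (s + 2))"
      unfolding y using profile_step[OF assms, of y] profile_step[OF assms, of "y - 1"] by auto
  qed
  have flip: "0 \<le> h x \<longleftrightarrow> \<not> 0 \<le> h (- 1 - x)" for x
    unfolding profile_flip[OF assms] by auto
  show ?thesis
    unfolding sym_core_set_def mem_Collect_eq
    by (intro conjI allI ballI flip bdd) (simp_all only: mem_Collect_eq order_trans[OF _ mono(1)]
        order_trans[OF _ mono(2)] order_trans[OF _ mono(3)])
qed

section \<open>Profiles from bead sets\<close>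

lemma exists_height:
  fixes S :: "int set"
  assumes sym: "\<And>x. x \<in> S \<longleftrightarrow> - 1 - x \<notin> S" and "bdd_above S" and "t > 0"
    and closed: "\<And>x. x \<in> S \<Longrightarrow> x - t \<in> S"
  shows "\<exists>a. \<forall>c. x + c * t \<in> S \<longleftrightarrow> c \<le> a"
proof -
  obtain M where M: "\<And>y. y \<in> S \<Longrightarrow> y \<le> M"
    using assms(2) by (auto simp: bdd_above_def)
  let ?C = "\<lambda>c. x + c * t \<in> S"
  have down: "?C (c - int n)" if "?C c" for c n
  proof (induction n)
    case (Suc n)
    then show ?case using closed[OF Suc] by (simp add: algebra_simps)
  qed (use that in simp)
  \<comment> \<open>\<open>B\<close> is so large that \<open>x + B * t\<close> and the reflection of
    \<open>x - B * t\<close> both exceed \<open>M\<close>: the column is empty at level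
    \<open>B\<close> and filled at level \<open>- B\<close>.\<close>
  define B where "B = \<bar>M\<bar> + \<bar>x\<bar> + 2"
  have "B \<le> B * t" using \<open>t > 0\<close> unfolding B_def by (intro mult_le_cancel_left1[THEN iffD2]) auto
  moreover have "0 \<le> B" and "M < x + B" "M < B - 1 - x"
    by (simp_all add: B_def)
  ultimately have "x + B * t \<notin> S" "- 1 - (x - B * t) \<notin> S"
    using M[of "x + B * t"] M[of "- 1 - (x - B * t)"] by linarith+
  then have "\<not> ?C B" and "?C (- B)"
    using sym[of "x - B * t"] by simp_all
  \<comment> \<open>The first empty level, counted upwards from \<open>- B\<close>; the height is
    one less.\<close>
  define n where "n = (LEAST n. \<not> ?C (- B + int n))"
  have "\<not> ?C (- B + int (nat (2 * B)))"
    using \<open>\<not> ?C B\<close> by (simp add: \<open>0 \<le> B\<close>)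
  then have n: "\<not> ?C (- B + int n)"
    unfolding n_def by (rule LeastI)
  have n': "?C (- B + int k)" if "k < n" for k
    using not_less_Least[of k "\<lambda>n. \<not> ?C (- B + int n)"] that by (simp add: n_def)
  have "?C c \<longleftrightarrow> c \<le> - B + int n - 1" for c
  proof
    assume "?C c"
    then show "c \<le> - B + int n - 1"
      using down[of c "nat (c - (- B + int n))"] n by (cases "c \<le> - B + int n - 1") auto
  next
    assume c: "c \<le> - B + int n - 1"
    have "n > 0" using n \<open>?C (- B)\<close> by (cases n) auto
    then show "?C c"
      using n'[of "n - 1"] down[of "- B + int n - 1" "nat (- B + int n - 1 - c)"] c
      by (simp add: of_nat_diff algebra_simps)
  qed
  then show ?thesis by blast
qed

text \<open>The set gives back \<open>h x\<close> as the largest \<open>c\<close> with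
  \<open>x + c * (int s + 1)\<close> in it. Corners become passages from negative to nonnegative
  height.\<close>

lemma bij_betw_profile:
  "bij_betw (\<lambda>h. {x. 0 \<le> h x})
    {h. profile s h \<and> card {x. 0 \<le> h x \<and> h (x - 1) < 0} = m}
    {S. sym_core_set s S \<and> card {x \<in> S. x - 1 \<notin> S} = m}"
  (is "bij_betw ?f ?P ?Q")
proof (rule bij_betw_imageI)
  show "inj_on ?f ?P"
  proof (rule inj_onI)
    fix g h assume gh: "g \<in> ?P" "h \<in> ?P" "?f g = ?f h"
    have "a \<le> g x \<longleftrightarrow> a \<le> h x" for a x
    proof -
      have "0 \<le> g (x + a * (int s + 1)) \<longleftrightarrow> 0 \<le> h (x + a * (int s + 1))"
        using gh(3) by (auto simp: set_eq_iff)
      then show ?thesis using gh(1,2) by (simp add: profile_shift)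
    qed
    then show "g = h" by (meson ext order_antisym order_refl)
  qed
  show "?f ` ?P = ?Q"
  proof (intro equalityI subsetI)
    fix S assume "S \<in> ?f ` ?P"
    then show "S \<in> ?Q" using sym_core_set_profile by (auto simp: not_le)
  next
    fix S assume S: "S \<in> ?Q"
    then have core: "sym_core_set s S" by blast
    note sym = sym_core_set_flip[OF core] and closed = sym_core_set_closed[OF core]
    have "\<forall>x. \<exists>a. \<forall>c. x + c * (int s + 1) \<in> S \<longleftrightarrow> c \<le> a"
      using exists_height[OF sym sym_core_set_bdd_above[OF core] _ closed(2)] by simp
    then obtain h where h: "\<And>x c. x + c * (int s + 1) \<in> S \<longleftrightarrow> c \<le> h x"
      by metis
    have h_eqI: "h x = a" if "\<And>c. x + c * (int s + 1) \<in> S \<longleftrightarrow> c \<le> a" for x a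
      using that h[of x] by (meson order_antisym order_refl)
    have "profile s h"
      unfolding profile_def
    proof (intro conjI allI)
      fix x
      show "h (x + (int s + 1)) = h x - 1"
        using h[of x "c + 1" for c] by (intro h_eqI) (simp add: algebra_simps)
      show "h (- 1 - x) = - 1 - h x"
      proof (rule h_eqI)
        fix c
        have "- 1 - x + c * (int s + 1) \<in> S \<longleftrightarrow> x + (- c) * (int s + 1) \<notin> S"
          using sym[of "- 1 - x + c * (int s + 1)"] by (simp add: algebra_simps)
        then show "- 1 - x + c * (int s + 1) \<in> S \<longleftrightarrow> c \<le> - 1 - h x"
          unfolding h by auto
      qed
      \<comment> \<open>The top member of the column of \<open>x\<close>, lowered by
        \<open>s\<close>, is at level \<open>h x - 1\<close> in the column of \<open>x + 1\<close>;
        lowering by \<open>s + 2\<close> leads back from \<open>x + 1\<close> to \<open>x\<close> in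
        the same way.\<close>
      have "x + h x * (int s + 1) - int s \<in> S"
        "x + 1 + h (x + 1) * (int s + 1) - (int s + 2) \<in> S"
        using closed(1)[OF iffD2[OF h order_refl], of x]
          closed(3)[OF iffD2[OF h order_refl], of "x + 1"] by blast+
      then show "\<bar>h (x + 1) - h x\<bar> \<le> 1"
        using h[of "x + 1" "h x - 1"] h[of x "h (x + 1) - 1"] by (auto simp: algebra_simps)
    qed
    moreover have "S = ?f h"
      using h[of _ 0] by auto
    ultimately show "S \<in> ?f ` ?P"
      using S by (intro image_eqI[of _ _ h]) (auto simp: not_le)
  qed
qed

subsection \<open>Half periods as step words\<close>

text \<open>For even \<open>s\<close> the argument is fixed by the reflection. For odd
  \<open>s\<close> the two middle heights add up to -2 and differ by at most 1, so both are
  -1.\<close>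

lemma profile_middle:
  assumes "profile s h"
  shows "h (int (s div 2)) = - 1"
proof (cases "even s")
  case True
  then have "int s - int (s div 2) = int (s div 2)" by presburger
  then show ?thesis using profile_reflect[OF assms, of "int (s div 2)"] by simp
next
  case False
  then have "int s - int (s div 2) = int (s div 2) + 1" by presburger
  then show ?thesis
    using profile_reflect[OF assms, of "int (s div 2)"] profile_step[OF assms, of "int (s div 2)"]
    by simp
qed

text \<open>The heights at -1 and 0 add up to -1 and differ by at most 1.\<close>

lemma profile_zero:
  assumes "profile s h"
  shows "h 0 \<in> {- 1, 0}"
  using profile_flip[OF assms, of 0] profile_step[OF assms, of "- 1"] by auto

definition half_steps :: "nat \<Rightarrow> (int \<Rightarrow> int) \<Rightarrow> int list" where
  "half_steps n h = map (\<lambda>k. h (int k + 1) - h (int k)) [0..<n]"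

text \<open>Telescoping over suffixes, because the known height of a profile is the one at the right
  end, \<open>s div 2\<close>.\<close>

lemma sum_list_drop_half_steps:
  assumes "k \<le> n"
  shows "sum_list (drop k (half_steps n h)) = h (int n) - h (int k)"
  using assms
proof (induction rule: inc_induct)
  case base
  then show ?case by (simp add: half_steps_def)
next
  case (step k)
  then have "drop k (half_steps n h) = (h (int k + 1) - h (int k)) # drop (Suc k) (half_steps n h)"
    using Cons_nth_drop_Suc[of k "half_steps n h"] by (simp add: half_steps_def)
  then show ?case using step by (simp add: add.commute)
qed

text \<open>The centre \<open>s/2\<close> extends agreement to a whole period, and quasi-periodicity
  to all integers.\<close>

lemma profile_eqI:
  assumes "profile s g" "profile s h" and half: "\<And>k. k \<le> s div 2 \<Longrightarrow> g (int k) = h (int k)"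
  shows "g = h"
proof
  have low: "g (int k) = h (int k)" if "k \<le> s" for k
  proof (cases "k \<le> s div 2")
    case False
    then have "g (int (s - k)) = h (int (s - k))" by (intro half) auto
    then show ?thesis
      using profile_reflect[OF assms(1), of "int k"] profile_reflect[OF assms(2), of "int k"] that
      by (simp add: of_nat_diff)
  qed (rule half)
  fix x
  have "0 \<le> x mod (int s + 1)" "x mod (int s + 1) < int s + 1"
    using pos_mod_sign[of "int s + 1" x] pos_mod_bound[of "int s + 1" x] by auto
  then have "g (x mod (int s + 1)) = h (x mod (int s + 1))"
    using low[of "nat (x mod (int s + 1))"] by simp
  then show "g x = h x"
    using profile_div_mod[OF assms(1), of x] profile_div_mod[OF assms(2), of x] by simp
qed

lemma half_steps_inj:
  assumes "profile s g" "profile s h" "half_steps (s div 2) g = half_steps (s div 2) h"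
  shows "g = h"
proof (rule profile_eqI[OF assms(1,2)])
  fix k assume "k \<le> s div 2"
  then show "g (int k) = h (int k)"
    using sum_list_drop_half_steps[of k "s div 2"] assms(3)
      profile_middle[OF assms(1)] profile_middle[OF assms(2)]
    by (metis diff_left_imp_eq)
qed

section \<open>Ascents in a full period and in a half period\<close>

text \<open>Moving \<open>x\<close> within its column shifts \<open>h (x - 1)\<close> and \<open>h x\<close> equally, so every ascent has exactly
  one translate going from \<open>-1\<close> to \<open>0\<close>.\<close>

lemma card_profile_ascents:
  assumes "profile s h"
  shows "card {x. 0 \<le> h x \<and> h (x - 1) < 0} = card {r \<in> {0..int s}. h r - h (r - 1) = 1}"
proof (rule bij_betw_same_card)
  let ?t = "int s + 1"
  have shift: "h (x - y div ?t * ?t) = h x + y div ?t" for x y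
    using profile_shift[OF assms, of x "- (y div ?t)"] by simp
  have mod: "h (x mod ?t) = h x + x div ?t" "h (x mod ?t - 1) = h (x - 1) + x div ?t" for x
    using shift[of x x] shift[of "x - 1" x]
    by (simp_all add: minus_div_mult_eq_mod[symmetric] algebra_simps)
  show "bij_betw (\<lambda>x. x mod ?t) {x. 0 \<le> h x \<and> h (x - 1) < 0}
      {r \<in> {0..int s}. h r - h (r - 1) = 1}"
  proof (rule bij_betwI[where g = "\<lambda>r. r + h r * ?t"])
    show "(\<lambda>x. x mod ?t) \<in> {x. 0 \<le> h x \<and> h (x - 1) < 0} \<rightarrow> {r \<in> {0..int s}. h r - h (r - 1) = 1}"
    proof
      fix x assume "x \<in> {x. 0 \<le> h x \<and> h (x - 1) < 0}"
      then have "h x - h (x - 1) = 1" using profile_step[OF assms, of "x - 1"] by auto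
      moreover have "0 \<le> x mod ?t" "x mod ?t < ?t"
        using pos_mod_sign[of ?t x] pos_mod_bound[of ?t x] by auto
      ultimately show "x mod ?t \<in> {r \<in> {0..int s}. h r - h (r - 1) = 1}"
        by (simp add: mod)
    qed
    show "(\<lambda>r. r + h r * ?t) \<in> {r \<in> {0..int s}. h r - h (r - 1) = 1} \<rightarrow> {x. 0 \<le> h x \<and> h (x - 1) < 0}"
    proof
      fix r assume "r \<in> {r \<in> {0..int s}. h r - h (r - 1) = 1}"
      moreover have "h (r + h r * ?t) = 0" "h (r + h r * ?t - 1) = h (r - 1) - h r"
        using profile_shift[OF assms, of r "h r"] profile_shift[OF assms, of "r - 1" "h r"]
        by (simp_all add: diff_add_eq)
      ultimately show "r + h r * ?t \<in> {x. 0 \<le> h x \<and> h (x - 1) < 0}"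
        by simp
    qed
  next
    fix x assume "x \<in> {x. 0 \<le> h x \<and> h (x - 1) < 0}"
    then have "h x = 0" using profile_step[OF assms, of "x - 1"] by auto
    then show "x mod ?t + h (x mod ?t) * ?t = x" by (simp only: mod add_0 mod_div_mult_eq)
  next
    fix r assume "r \<in> {r \<in> {0..int s}. h r - h (r - 1) = 1}"
    then show "(r + h r * ?t) mod ?t = r" by simp
  qed
qed

text \<open>Reflection about \<open>s/2\<close> reverses both positions and heights, so it preserves
  steps, and each ascent of the half period occurs twice. What remains is the step into 0, an ascent
  iff \<open>h 0 = 0\<close>, and for odd \<open>s\<close> a flat middle step.\<close>

lemma card_half_ascents:
  assumes "profile s h"
  shows "card {r \<in> {0..int s}. h r - h (r - 1) = 1} =
    (if h 0 = 0 then 1 else 0) + 2 * card {k. k < s div 2 \<and> h (int k + 1) - h (int k) = 1}"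
proof -
  let ?n = "s div 2"
  let ?A = "{k. k < ?n \<and> h (int k + 1) - h (int k) = 1}"
  let ?Z = "if h 0 = 0 then {0} else {} :: int set"
  have flip: "h (int s - int k) - h (int s - int k - 1) = h (int k + 1) - h (int k)" for k
    using profile_reflect[OF assms, of "int k"] profile_reflect[OF assms, of "int k + 1"]
    by (simp add: algebra_simps)
  have zero: "h 0 - h (- 1) = 1 \<longleftrightarrow> h 0 = 0"
    using profile_flip[OF assms, of 0] by auto
  have "{r \<in> {0..int s}. h r - h (r - 1) = 1} =
    ?Z \<union> ((\<lambda>k. int k + 1) ` ?A \<union> (\<lambda>k. int s - int k) ` ?A)" (is "?L = ?R")
  proof (intro equalityI subsetI)
    fix r assume "r \<in> ?L"
    then have r: "0 \<le> r" "r \<le> int s" "h r - h (r - 1) = 1" by auto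
    have "r = 0 \<or> 0 < r \<and> r \<le> int ?n \<or> int s - int ?n < r \<or> r = int ?n + 1 \<and> odd s"
      using r(1) by presburger
    then consider "r = 0" | "0 < r" "r \<le> int ?n" | "int s - int ?n < r" | "r = int ?n + 1" "odd s"
      by blast
    then show "r \<in> ?R"
    proof cases
      case 1
      then show ?thesis using r zero by simp
    next
      case 2
      then have "r = int (nat (r - 1)) + 1" "nat (r - 1) \<in> ?A" using r by auto
      then show ?thesis by blast
    next
      case 3
      then have "r = int s - int (nat (int s - r))" using r by simp
      moreover have "nat (int s - r) \<in> ?A"
        using 3 r flip[of "nat (int s - r)"] by auto
      ultimately show ?thesis by blast
    next
      case 4
      then have "int s - int ?n = int ?n + 1" by presburger
      then have "h (int ?n + 1) = h (int ?n)"
        using profile_reflect[OF assms, of "int ?n"] profile_middle[OF assms] by simp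
      then show ?thesis using 4 r by simp
    qed
  next
    fix r assume "r \<in> ?R"
    then consider "r = 0" "h 0 = 0" | k where "k \<in> ?A" "r = int k + 1"
      | k where "k \<in> ?A" "r = int s - int k"
      by (auto split: if_splits)
    then show "r \<in> ?L"
      using zero by cases (auto simp: flip)
  qed
  moreover have "card ?R = card ?Z + (card ?A + card ?A)"
  proof -
    have "card ((\<lambda>k. int k + 1) ` ?A) = card ?A" "card ((\<lambda>k. int s - int k) ` ?A) = card ?A"
      by (auto intro!: card_image inj_onI)
    moreover have "(\<lambda>k. int k + 1) ` ?A \<inter> (\<lambda>k. int s - int k) ` ?A = {}"
      by auto
    moreover have "?Z \<inter> ((\<lambda>k. int k + 1) ` ?A \<union> (\<lambda>k. int s - int k) ` ?A) = {}"
      by auto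
    ultimately show ?thesis by (simp add: card_Un_disjoint)
  qed
  ultimately show ?thesis by simp
qed

lemma count_step_word:
  fixes w :: "int list"
  assumes "set w \<subseteq> {- 1, 0, 1}"
  shows "length w = count_list w 1 + count_list w (- 1) + count_list w 0"
    and "sum_list w = int (count_list w 1) - int (count_list w (- 1))"
  using assms by (induction w) auto

lemma set_half_steps:
  assumes "profile s h"
  shows "set (half_steps n h) \<subseteq> {- 1, 0, 1}"
proof
  fix d assume "d \<in> set (half_steps n h)"
  then obtain k where "d = h (int k + 1) - h (int k)"
    by (auto simp: half_steps_def)
  then show "d \<in> {- 1, 0, 1}"
    using profile_step[OF assms, of "int k"] by auto
qed

text \<open>Ups minus downs is \<open>- 1 - h 0\<close>. If \<open>h 0 = 0\<close>, the extra ascent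
  at 0 makes up for the one missing up step; if \<open>h 0 = - 1\<close>, ups and downs are equally
  many. Either way doubling the ups gives the total.\<close>

lemma profile_ascents_eq_nonzero_steps:
  assumes "profile s h"
  defines "w \<equiv> half_steps (s div 2) h"
  shows "card {x. 0 \<le> h x \<and> h (x - 1) < 0} = count_list w 1 + count_list w (- 1)"
proof -
  have set_w: "set w \<subseteq> {- 1, 0, 1}"
    unfolding w_def by (rule set_half_steps[OF assms(1)])
  have "count_list w 1 = card {k. k < s div 2 \<and> h (int k + 1) - h (int k) = 1}"
    unfolding count_list_eq_length_filter length_filter_conv_card
    by (auto simp: w_def half_steps_def intro!: arg_cong[where f = card])
  moreover have "int (count_list w 1) - int (count_list w (- 1)) = - 1 - h 0"
    using count_step_word(2)[OF set_w] sum_list_drop_half_steps[of 0 "s div 2" h]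
      profile_middle[OF assms(1)] by (simp add: w_def)
  ultimately show ?thesis
    using card_profile_ascents[OF assms(1)] card_half_ascents[OF assms(1)] profile_zero[OF assms(1)]
    by auto
qed

section \<open>Rebuilding a profile from its half period\<close>

lemma exists_profile:
  fixes w :: "int list"
  assumes len: "length w = s div 2" and steps: "set w \<subseteq> {- 1, 0, 1}"
    and sum: "sum_list w \<in> {- 1, 0}"
  shows "\<exists>h. profile s h \<and> half_steps (s div 2) h = w"
proof -
  let ?t = "int s + 1"
  let ?n = "s div 2"
  \<comment> \<open>Heights are built backwards from the forced value -1 at \<open>s div 2\<close>:
    \<open>P\<close> covers the half period, \<open>H\<close> reflects it onto the whole period, and
    \<open>h\<close> continues quasi-periodically.\<close>
  define P where "P k = - 1 - sum_list (drop k w)" for k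
  define H where "H x = (if x \<le> int ?n then P (nat x) else - 2 - P (nat (int s - x)))" for x
  define h where "h x = H (x mod ?t) - x div ?t" for x
  have P_n: "P ?n = - 1" by (simp add: P_def len)
  have P_step: "P (Suc k) - P k = w ! k" if "k < ?n" for k
    using Cons_nth_drop_Suc[of k w] that len by (simp add: P_def flip: Cons_nth_drop_Suc)
  have w_nth: "\<bar>w ! k\<bar> \<le> 1" if "k < ?n" for k
    using subsetD[OF steps nth_mem[of k w]] that len by auto
  have H_reflect: "H (int s - x) = - 2 - H x" if "0 \<le> x" "x \<le> int s" for x
  proof -
    consider "x \<le> int ?n" "int s - x > int ?n" | "x > int ?n" "int s - x \<le> int ?n"
      | "x = int ?n" "int s - x = int ?n"
      by linarith
    then show ?thesis by cases (auto simp: H_def P_n)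
  qed
  have H_step: "\<bar>H (x + 1) - H x\<bar> \<le> 1" if "0 \<le> x" "x < int s" for x
  proof -
    have low: "\<bar>H (x + 1) - H x\<bar> \<le> 1" if "0 \<le> x" "x < int ?n" for x
      using P_step[of "nat x"] w_nth[of "nat x"] that by (simp add: H_def nat_add_distrib)
    consider "x < int ?n" | "int s - 1 - x < int ?n" | "x = int ?n" "int s - (x + 1) = int ?n"
      by linarith
    then show ?thesis
    proof cases
      case 2
      then show ?thesis
        using low[of "int s - 1 - x"] H_reflect[of x] H_reflect[of "x + 1"] that
        by (simp add: algebra_simps)
    next
      case 3
      \<comment> \<open>This is the middle step for odd \<open>s\<close>, joining the two halves; it
        is flat.\<close>
      have "H (int ?n) = - 1" by (simp add: H_def P_n)
      then show ?thesis using H_reflect[of "x + 1", unfolded 3(2)] that 3(1) by simp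
    qed (use low that in blast)
  qed
  have H_0: "H 0 \<in> {- 1, 0}"
    using sum by (auto simp: H_def P_def)
  have h_eq: "h (r + a * ?t) = H r - a" if "0 \<le> r" "r \<le> int s" for r a
    using that by (simp add: h_def)
  have split: "\<exists>r a. x = r + a * ?t \<and> 0 \<le> r \<and> r \<le> int s" for x
  proof (intro exI conjI)
    show "x = x mod ?t + x div ?t * ?t" by (simp only: mod_div_mult_eq)
    show "x mod ?t \<le> int s" using pos_mod_bound[of ?t x] by linarith
  qed simp
  have "profile s h"
    unfolding profile_def
  proof (intro conjI allI)
    fix x
    obtain r a where x: "x = r + a * ?t" and r: "0 \<le> r" "r \<le> int s"
      using split by blast
    have hx: "h x = H r - a"
      unfolding x by (rule h_eq[OF r])
    have "x + ?t = r + (a + 1) * ?t" by (simp add: x algebra_simps)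
    then have "h (x + ?t) = H r - (a + 1)"
      using h_eq[OF r] by (simp only:)
    then show "h (x + ?t) = h x - 1"
      by (simp add: hx)
    \<comment> \<open>The reflection turns remainder \<open>r\<close> and quotient \<open>a\<close>
      into \<open>int s - r\<close> and \<open>- a - 1\<close>.\<close>
    have "- 1 - x = (int s - r) + (- a - 1) * ?t" by (simp add: x algebra_simps)
    then have "h (- 1 - x) = H (int s - r) - (- a - 1)"
      using h_eq[of "int s - r" "- a - 1"] r by simp
    then show "h (- 1 - x) = - 1 - h x"
      using H_reflect[OF r] by (simp add: hx)
    show "\<bar>h (x + 1) - h x\<bar> \<le> 1"
    proof (cases "r = int s")
      case True
      \<comment> \<open>The seam between two periods: the step is \<open>2 * H 0 + 1\<close>, which
        has size 1 because the assumption on the sum puts \<open>H 0\<close> in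
        \<open>{- 1, 0}\<close>.\<close>
      have "x + 1 = 0 + (a + 1) * ?t" by (simp add: x True algebra_simps)
      then have "h (x + 1) = H 0 - (a + 1)"
        using h_eq[of 0 "a + 1"] by simp
      moreover have "h x = - 2 - H 0 - a"
        using H_reflect[of 0] by (simp add: hx True)
      ultimately show ?thesis using H_0 by auto
    next
      case False
      have "x + 1 = (r + 1) + a * ?t" by (simp add: x)
      moreover have "h ((r + 1) + a * ?t) = H (r + 1) - a"
        using r False by (intro h_eq) auto
      ultimately have "h (x + 1) = H (r + 1) - a" by (simp only:)
      then show ?thesis
        using H_step[of r] r False by (simp add: hx)
    qed
  qed
  moreover have "half_steps ?n h = w"
  proof (rule nth_equalityI)
    fix k assume "k < length (half_steps ?n h)"
    then have k: "k < ?n" by (simp add: half_steps_def)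
    then have "h (int k) = P k" "h (int k + 1) = P (Suc k)"
      using h_eq[of "int k" 0] h_eq[of "int k + 1" 0] by (auto simp: H_def nat_add_distrib)
    then show "half_steps ?n h ! k = w ! k"
      using P_step[OF k] k by (simp add: half_steps_def)
  qed (simp add: half_steps_def len)
  ultimately show ?thesis by blast
qed

section \<open>Counting step words\<close>

definition step_words :: "nat \<Rightarrow> nat \<Rightarrow> int list set" where
  "step_words n m = {w. length w = n \<and> set w \<subseteq> {- 1, 0, 1} \<and> sum_list w \<in> {- 1, 0} \<and>
     count_list w 1 + count_list w (- 1) = m}"

text \<open>The half steps sum to \<open>- 1 - h 0\<close>, so the two admissible sums match the two
  possible values of \<open>h 0\<close>.\<close>

lemma bij_betw_half_steps:
  "bij_betw (half_steps (s div 2))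
    {h. profile s h \<and> card {x. 0 \<le> h x \<and> h (x - 1) < 0} = m} (step_words (s div 2) m)"
  (is "bij_betw ?f ?P ?W")
proof (rule bij_betw_imageI)
  show "inj_on ?f ?P"
    by (auto intro: inj_onI half_steps_inj)
  show "?f ` ?P = ?W"
  proof (intro equalityI subsetI)
    fix w assume "w \<in> ?f ` ?P"
    then obtain h where w: "w = ?f h" and h: "profile s h"
      and m: "card {x. 0 \<le> h x \<and> h (x - 1) < 0} = m" by blast
    have "set w \<subseteq> {- 1, 0, 1}"
      unfolding w by (rule set_half_steps[OF h])
    moreover have "sum_list w = - 1 - h 0"
      using sum_list_drop_half_steps[of 0 "s div 2" h] profile_middle[OF h] by (simp add: w)
    ultimately show "w \<in> ?W"
      using profile_zero[OF h] profile_ascents_eq_nonzero_steps[OF h] m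
      by (auto simp: step_words_def w half_steps_def)
  next
    fix w assume w: "w \<in> ?W"
    then obtain h where h: "profile s h" "?f h = w"
      using exists_profile[of w s] by (auto simp: step_words_def)
    then have "h \<in> ?P"
      using profile_ascents_eq_nonzero_steps[OF h(1)] w by (simp add: step_words_def)
    then show "w \<in> ?f ` ?P" using h(2) by blast
  qed
qed

text \<open>Ups minus downs is 0 or -1 while together they number \<open>m\<close>; the parity of
  \<open>m\<close> decides which, and all three letter counts are forced.\<close>

lemma step_words_eq:
  assumes "m \<le> n"
  shows "step_words n m = permutations_of_multiset
    (replicate_mset (m div 2) 1 + replicate_mset ((m + 1) div 2) (- 1) + replicate_mset (n - m) 0)"
    (is "_ = permutations_of_multiset ?M")
proof (intro equalityI subsetI)
  fix w assume w: "w \<in> step_words n m"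
  then have set_w: "set w \<subseteq> {- 1, 0, 1}" and sum: "sum_list w \<in> {- 1, 0}"
    and m: "count_list w 1 + count_list w (- 1) = m" and n: "length w = n"
    by (auto simp: step_words_def)
  have "count_list w 1 = m div 2" "count_list w (- 1) = (m + 1) div 2" "count_list w 0 = n - m"
    using count_step_word[OF set_w] sum m n by auto
  moreover have "count_list w x = 0" if "x \<notin> {- 1, 0, 1}" for x
    using that set_w by (auto simp: count_list_0_iff)
  ultimately have "mset w = ?M"
    by (intro multiset_eqI) (auto simp: count_mset)
  then show "w \<in> permutations_of_multiset ?M" by (rule permutations_of_multisetI)
next
  fix w assume "w \<in> permutations_of_multiset ?M"
  then have M: "mset w = ?M" by (rule permutations_of_multisetD)
  have "set w \<subseteq> {- 1, 0, 1}"
    using arg_cong[OF M, of set_mset] by (auto split: if_splits)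
  moreover have "count_list w 1 = m div 2" "count_list w (- 1) = (m + 1) div 2"
    using M by (simp_all flip: count_mset)
  moreover have "length w = n"
    using arg_cong[OF M, of size] assms by simp
  ultimately show "w \<in> step_words n m"
    using count_step_word(2)[of w] by (auto simp: step_words_def)
qed

text \<open>Arrangements of a multiset are counted by a multinomial coefficient. For
  \<open>m > n\<close> there are no words, in agreement with the convention for a negative
  entry.\<close>

lemma card_step_words:
  "card (step_words n m) =
    multinomial3 n (int (m div 2)) (int ((m + 1) div 2)) (int n - int m)"
proof (cases "m \<le> n")
  case True
  let ?M = "replicate_mset (m div 2) (1 :: int) + replicate_mset ((m + 1) div 2) (- 1) +
    replicate_mset (n - m) 0"
  \<comment> \<open>Letters that do not occur contribute \<open>fact 0 = 1\<close>, so the product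
    may run over all three.\<close>
  have prod: "(\<Prod>x\<in>set_mset ?M. fact (count ?M x) :: nat) =
      (\<Prod>x\<in>{1, - 1, 0}. fact (count ?M x))"
    by (rule prod.mono_neutral_left) (auto simp: not_in_iff split: if_splits)
  have "size ?M = n" using True by simp
  then show ?thesis
    unfolding step_words_eq[OF True] card_permutations_of_multiset prod
    using True by (simp add: multinomial3_def nat_diff_distrib mult.assoc)
next
  case False
  have "step_words n m = {}"
    using False count_step_word(1) by (fastforce simp: step_words_def)
  then show ?thesis using False by (simp add: multinomial3_def)
qed

lemma finite_step_words: "finite (step_words n m)"
proof (rule finite_subset)
  show "step_words n m \<subseteq> {w. set w \<subseteq> {- 1, 0, 1} \<and> length w = n}"
    by (auto simp: step_words_def)
qed (simp add: finite_lists_length_eq)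

section \<open>Composition of the bijections\<close>

theorem proposition3p9:
  fixes s m :: nat
  assumes "s > 0"
  shows "finite {p. is_partition p \<and> self_conjugate p \<and>
             is_multi_core [s, s + 1, s + 2] p \<and> corners p = m} \<and>
         card {p. is_partition p \<and> self_conjugate p \<and>
             is_multi_core [s, s + 1, s + 2] p \<and> corners p = m} =
         multinomial3 (s div 2) (int (m div 2)) (int ((m + 1) div 2))
           (int (s div 2) - int m)"
proof -
  let ?P = "{p. is_partition p \<and> self_conjugate p \<and>
             is_multi_core [s, s + 1, s + 2] p \<and> corners p = m}"
  let ?H = "{h. profile s h \<and> card {x. 0 \<le> h x \<and> h (x - 1) < 0} = m}"
  let ?S = "{S. sym_core_set s S \<and> card {x \<in> S. x - 1 \<notin> S} = m}"
  have PS: "bij_betw beta_set ?P ?S"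
    by (rule bij_betw_beta_set[OF assms])
  have HS: "bij_betw (\<lambda>h. {x. 0 \<le> h x}) ?H ?S"
    by (rule bij_betw_profile)
  have HW: "bij_betw (half_steps (s div 2)) ?H (step_words (s div 2) m)"
    by (rule bij_betw_half_steps)
  have "finite ?P"
    using bij_betw_finite[OF PS] bij_betw_finite[OF HS] bij_betw_finite[OF HW] finite_step_words
    by blast
  moreover have "card ?P = card (step_words (s div 2) m)"
    using bij_betw_same_card[OF PS] bij_betw_same_card[OF HS] bij_betw_same_card[OF HW] by simp
  ultimately show ?thesis using card_step_words by simp
qed

end
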